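(* Let $\alpha_1,\dots,\alpha_4,\beta_1,\dots,\beta_4$ be real numbers. The double inequalities $$\alpha_{1}A(a,b)+(1-\alpha_{1})H(a,b)<N_{AH}(a,b)<\beta_{1}A(a,b)+(1-\beta_{1})H(a,b),$$ $$\alpha_{2}A(a,b)+(1-\alpha_{2})H(a,b)<N_{HA}(a,b)<\beta_{2}A(a,b)+(1-\beta_{2})H(a,b),$$ $$\alpha_{3}C(a,b)+(1-\alpha_{3})A(a,b)<N_{CA}(a,b)<\beta_{3}C(a,b)+(1-\beta_{3})A(a,b),$$ $$\alpha_{4}C(a,b)+(1-\alpha_{4})A(a,b)<N_{AC}(a,b)<\beta_{4}C(a,b)+(1-\beta_{4})A(a,b)$$ hold for all $a,b>0$ with $a\neq b$ if and only if $\alpha_{1}\leq 1/3$, $\beta_{1}\geq 1/2$, $\alpha_{2}\leq 2/3$, $\beta_{2}\geq \pi/4$, $\alpha_{3}\leq 1/3$, $\beta_{3}\geq\sqrt{3}\log(2+\sqrt{3})/6$, $\alpha_{4}\leq 2/3$ and $\beta_{4}\geq(4\sqrt{3}\pi-9)/18$.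
   Context: For $a,b>0$: $H(a,b)=\frac{2ab}{a+b}$ (harmonic mean), $A(a,b)=\frac{a+b}{2}$ (arithmetic mean), $C(a,b)=\frac{a^2+b^2}{a+b}$ (contraharmonic mean). For $x,y>0$ with $x\neq y$, the Schwab-Borchardt mean is $$SB(x,y)=\begin{cases}\dfrac{\sqrt{y^2-x^2}}{\cos^{-1}(x/y)}, & x<y,\\[2mm] \dfrac{\sqrt{x^2-y^2}}{\cosh^{-1}(x/y)}, & x>y,\end{cases}$$ where $\cos^{-1}$ is the inverse cosine and $\cosh^{-1}(x)=\log(x+\sqrt{x^2-1})$. The Neuman mean is $$N(x,y)=\frac12\left[x+\frac{y^2}{SB(x,y)}\right].$$ For $a\ne b$: $N_{AH}(a,b)=N(A(a,b),H(a,b))$, $N_{HA}(a,b)=N(H(a,b),A(a,b))$, $N_{CA}(a,b)=N(C(a,b),A(a,b))$, $N_{AC}(a,b)=N(A(a,b),C(a,b))$. *)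

theory Defs
  imports Complex_Main
begin

definition harmonic_mean :: "real \<Rightarrow> real \<Rightarrow> real" where
  "harmonic_mean a b = 2 * a * b / (a + b)"

definition arithmetic_mean :: "real \<Rightarrow> real \<Rightarrow> real" where
  "arithmetic_mean a b = (a + b) / 2"

definition contraharmonic_mean :: "real \<Rightarrow> real \<Rightarrow> real" where
  "contraharmonic_mean a b = (a\<^sup>2 + b\<^sup>2) / (a + b)"

(* The mean is meant for positive arguments x, y with x different from y; on the
   diagonal the value below is an artefact of totality.  In the second case x / y > 1,
   where arcosh t = ln (t + sqrt (t^2 - 1)) by arcosh_real_def. *)
definition schwab_borchardt_mean :: "real \<Rightarrow> real \<Rightarrow> real" where
  "schwab_borchardt_mean x y =
     (if x < y then sqrt (y\<^sup>2 - x\<^sup>2) / arccos (x / y)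
      else sqrt (x\<^sup>2 - y\<^sup>2) / arcosh (x / y))"

definition neuman_mean :: "real \<Rightarrow> real \<Rightarrow> real" where
  "neuman_mean x y = (1 / 2) * (x + y\<^sup>2 / schwab_borchardt_mean x y)"

definition neuman_AH :: "real \<Rightarrow> real \<Rightarrow> real" where
  "neuman_AH a b = neuman_mean (arithmetic_mean a b) (harmonic_mean a b)"

definition neuman_HA :: "real \<Rightarrow> real \<Rightarrow> real" where
  "neuman_HA a b = neuman_mean (harmonic_mean a b) (arithmetic_mean a b)"

definition neuman_CA :: "real \<Rightarrow> real \<Rightarrow> real" where
  "neuman_CA a b = neuman_mean (contraharmonic_mean a b) (arithmetic_mean a b)"

definition neuman_AC :: "real \<Rightarrow> real \<Rightarrow> real" where
  "neuman_AC a b = neuman_mean (arithmetic_mean a b) (contraharmonic_mean a b)"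

end

theory Submission
  imports Defs "HOL-Real_Asymp.Real_Asymp"
begin

text \<open>
  For \<open>y < x\<close> write \<open>x = y cosh t\<close>, and for \<open>x < y\<close> write \<open>x = y cos t\<close>. In either case
  \<open>N(x, y)\<close> is a combination of the larger and the smaller argument in which the weight of
  the larger one depends on \<open>t\<close> only. These weights are affine functions of
  \<open>(t - sinh t) / (sinh t (cosh t - 1))\<close> and \<open>(t - sin t cos t) / (sin t (1 - cos t))\<close>, whose
  derivative quotients \<open>- 1 / (2 cosh t + 1)\<close> and \<open>1 + 1 / (1 + 2 cos t)\<close> are increasing, so the
  weights increase by the monotone form of l'Hospital's rule. With \<open>u = ((a - b) / (a + b))\<^sup>2\<close>,
  which ranges over all of \<open>(0, 1)\<close>, one has \<open>H = A (1 - u)\<close> and \<open>C = A (1 + u)\<close>; hence the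
  sharp constants are the limits of the weights at the ends of the ranges of \<open>t\<close>, namely
  \<open>(0, \<infinity>)\<close>, \<open>(0, \<pi>/2)\<close>, \<open>(0, arcosh 2)\<close> and \<open>(0, \<pi>/3)\<close>.
\<close>

section \<open>Monotone form of l'Hospital's rule\<close>

text \<open>Cauchy's mean value theorem on \<open>[a, s]\<close> and on \<open>[s, t]\<close> writes
  \<open>f s\<close> as \<open>r y * g s\<close> and the increment of \<open>f\<close> as
  \<open>r z\<close> times that of \<open>g\<close>, with \<open>y < s < z\<close>. Since
  \<open>g\<close> is positive and increasing past \<open>a\<close>, \<open>r y < r z\<close> makes
  the increment pull the quotient up. The relation between \<open>f'\<close> and \<open>g'\<close>
  is asked for only inside the interval, so both derivatives may vanish at \<open>a\<close>, as they
  do below.\<close>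

lemma quotient_less_of_deriv_quotient_mono:
  fixes f g r f' g' :: "real \<Rightarrow> real"
  assumes "a < s" "s < t"
    and f: "\<And>x. \<lbrakk>a \<le> x; x \<le> t\<rbrakk> \<Longrightarrow> (f has_real_derivative f' x) (at x)"
    and g: "\<And>x. \<lbrakk>a \<le> x; x \<le> t\<rbrakk> \<Longrightarrow> (g has_real_derivative g' x) (at x)"
    and "f a = 0" "g a = 0"
    and g'_pos: "\<And>x. \<lbrakk>a < x; x < t\<rbrakk> \<Longrightarrow> 0 < g' x"
    and f'_eq: "\<And>x. \<lbrakk>a < x; x < t\<rbrakk> \<Longrightarrow> f' x = r x * g' x"
    and r_mono: "\<And>x y. \<lbrakk>a < x; x < y; y < t\<rbrakk> \<Longrightarrow> r x < r y"
  shows "f s / g s < f t / g t"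
proof -
  have mvt: "\<exists>z. u < z \<and> z < v \<and> f v - f u = r z * (g v - g u)"
    if "a \<le> u" "u < v" "v \<le> t" for u v
  proof -
    have *: "isCont f x" "isCont g x" if "u \<le> x" "x \<le> v" for x
      using DERIV_isCont[OF f[of x]] DERIV_isCont[OF g[of x]] that \<open>a \<le> u\<close> \<open>v \<le> t\<close> by auto
    have "\<exists>z>u. z < v \<and> (f v - f u) * g' z = (g v - g u) * f' z"
    proof (rule GMVT')
      fix x assume "u < x" "x < v"
      then have "a \<le> x" "x \<le> t" using that by auto
      then show "(f has_real_derivative f' x) (at x)" "(g has_real_derivative g' x) (at x)"
        using f g by auto
    qed (use * \<open>u < v\<close> in auto)
    then obtain z where z: "u < z" "z < v" "(f v - f u) * g' z = (g v - g u) * f' z"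
      by blast
    moreover have "a < z" "z < t" using z that by auto
    then have "g' z > 0" "f' z = r z * g' z" by (fact g'_pos f'_eq)+
    ultimately have "f v - f u = r z * (g v - g u)"
      by simp
    then show ?thesis using z by blast
  qed
  have g_mono: "g u < g v" if "a \<le> u" "u < v" "v \<le> t" for u v
  proof (rule DERIV_pos_imp_increasing_open[OF \<open>u < v\<close>])
    fix x assume "u < x" "x < v"
    then have x: "a < x" "x < t" using that by auto
    then show "\<exists>y. (g has_real_derivative y) (at x) \<and> 0 < y"
      using g[of x] g'_pos[OF x] by (intro exI[of _ "g' x"]) auto
  next
    show "continuous_on {u..v} g"
      using that by (intro continuous_at_imp_continuous_on ballI DERIV_isCont[OF g]) auto
  qed
  obtain y where y: "a < y" "y < s" "f s = r y * g s"
    using mvt[OF order_refl \<open>a < s\<close>] \<open>s < t\<close> \<open>f a = 0\<close> \<open>g a = 0\<close> by auto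
  obtain z where z: "s < z" "z < t" "f t - f s = r z * (g t - g s)"
    using mvt[OF less_imp_le[OF \<open>a < s\<close>] \<open>s < t\<close>] by auto
  have gs: "0 < g s" and gst: "g s < g t"
    using g_mono[of a s] g_mono[of s t] \<open>a < s\<close> \<open>s < t\<close> \<open>g a = 0\<close> by auto
  have "r y * (g t - g s) < r z * (g t - g s)"
    using r_mono[of y z] y(1,2) z(1,2) gst by simp
  then have "r y * g t < f t"
    using y(3) z(3) by (simp add: algebra_simps)
  then show ?thesis
    using y(3) gs gst by (simp add: field_simps)
qed

section \<open>The two weights: monotonicity and limits\<close>

text \<open>The solution \<open>w\<close> of \<open>N(x, y) = w * x + (1 - w) * y\<close> for
  \<open>x = y * cosh t\<close>.\<close>

definition hyp_weight :: "real \<Rightarrow> real" where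
  "hyp_weight t = (cosh t + t / sinh t - 2) / (2 * (cosh t - 1))"

text \<open>The solution \<open>w\<close> of \<open>N(x, y) = w * y + (1 - w) * x\<close> for
  \<open>x = y * cos t\<close>.\<close>

definition trig_weight :: "real \<Rightarrow> real" where
  "trig_weight t = (t / sin t - cos t) / (2 * (1 - cos t))"

lemma hyp_weight_strict_mono:
  assumes "0 < s" "s < t"
  shows "hyp_weight s < hyp_weight t"
proof -
  \<comment> \<open>Splitting off \<open>1/2\<close> leaves the numerator \<open>x - sinh x\<close>,
    whose derivative shares the factor \<open>cosh x - 1\<close> with that of the
    denominator.\<close>
  have eq: "hyp_weight x = 1/2 + 1/2 * ((x - sinh x) / (sinh x * (cosh x - 1)))" if "0 < x" for x
  proof -
    have "cosh x > 1" using cosh_real_nonneg_less_iff[of 0 x] that by simp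
    moreover have "sinh x > 0" using that by simp
    ultimately show ?thesis
      by (simp add: hyp_weight_def divide_simps) (simp add: algebra_simps)
  qed
  have "(s - sinh s) / (sinh s * (cosh s - 1)) < (t - sinh t) / (sinh t * (cosh t - 1))"
  proof (rule quotient_less_of_deriv_quotient_mono[OF assms,
        where f' = "\<lambda>x. 1 - cosh x" and g' = "\<lambda>x. (2 * cosh x + 1) * (cosh x - 1)"
          and r = "\<lambda>x. - 1 / (2 * cosh x + 1)"])
    fix x :: real
    show "((\<lambda>x. x - sinh x) has_real_derivative 1 - cosh x) (at x)"
      by (auto intro!: derivative_eq_intros)
    show "((\<lambda>x. sinh x * (cosh x - 1)) has_real_derivative
      (2 * cosh x + 1) * (cosh x - 1)) (at x)"
      by (auto intro!: derivative_eq_intros)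
        (use cosh_square_eq[of x] in \<open>simp add: algebra_simps power2_eq_square\<close>)
  next
    fix x :: real assume "0 < x"
    then have "cosh x > 1" using cosh_real_nonneg_less_iff[of 0 x] by simp
    then show "0 < (2 * cosh x + 1) * (cosh x - 1)"
      and "1 - cosh x = - 1 / (2 * cosh x + 1) * ((2 * cosh x + 1) * (cosh x - 1))"
      by (auto simp: divide_simps)
  next
    fix x y :: real assume "0 < x" "x < y"
    then have "cosh x < cosh y" by (intro cosh_real_strict_mono) auto
    then show "- 1 / (2 * cosh x + 1) < - 1 / (2 * cosh y + 1)"
      using cosh_real_ge_1[of x] by (simp add: divide_simps)
  qed auto
  moreover have "0 < t" using assms by simp
  ultimately show ?thesis
    unfolding eq[OF assms(1)] eq[OF \<open>0 < t\<close>] by (intro add_strict_left_mono mult_strict_left_mono) auto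
qed

lemma trig_weight_strict_mono:
  assumes "0 < s" "s < t" "t \<le> pi / 2"
  shows "trig_weight s < trig_weight t"
proof -
  have cos: "0 < cos x" "cos x < 1" if "0 < x" "x < pi / 2" for x
    using that cos_monotone_0_pi[of 0 x] by (auto intro!: cos_gt_zero)
  have eq: "trig_weight x = 1/2 * ((x - sin x * cos x) / (sin x * (1 - cos x)))"
    if "0 < x" "x \<le> pi / 2" for x
  proof -
    have "cos x < 1" using that cos_monotone_0_pi[of 0 x] by auto
    moreover have "sin x > 0" using that by (intro sin_gt_zero) auto
    ultimately show ?thesis
      by (simp add: trig_weight_def divide_simps)
  qed
  have "(s - sin s * cos s) / (sin s * (1 - cos s)) < (t - sin t * cos t) / (sin t * (1 - cos t))"
  proof (rule quotient_less_of_deriv_quotient_mono[OF assms(1,2),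
        where f' = "\<lambda>x. 2 * (1 - cos x) * (1 + cos x)" and g' = "\<lambda>x. (1 - cos x) * (1 + 2 * cos x)"
          and r = "\<lambda>x. 1 + 1 / (1 + 2 * cos x)"])
    fix x :: real
    show "((\<lambda>x. x - sin x * cos x) has_real_derivative 2 * (1 - cos x) * (1 + cos x)) (at x)"
      by (auto intro!: derivative_eq_intros)
        (use sin_squared_eq[of x] in \<open>simp add: algebra_simps power2_eq_square\<close>)
    show "((\<lambda>x. sin x * (1 - cos x)) has_real_derivative (1 - cos x) * (1 + 2 * cos x)) (at x)"
      by (auto intro!: derivative_eq_intros)
        (use sin_squared_eq[of x] in \<open>simp add: algebra_simps power2_eq_square\<close>)
  next
    fix x :: real assume "0 < x" "x < t"
    then have "0 < cos x" "cos x < 1" using cos assms by auto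
    then show "0 < (1 - cos x) * (1 + 2 * cos x)"
      and "2 * (1 - cos x) * (1 + cos x) =
        (1 + 1 / (1 + 2 * cos x)) * ((1 - cos x) * (1 + 2 * cos x))"
      by (auto simp: divide_simps) (auto simp: algebra_simps)
  next
    fix x y :: real assume "0 < x" "x < y" "y < t"
    then have "cos y < cos x" "0 < cos y"
      using assms cos by (auto intro!: cos_monotone_0_pi)
    then show "1 + 1 / (1 + 2 * cos x) < 1 + 1 / (1 + 2 * cos y)"
      by (auto intro!: divide_strict_left_mono mult_pos_pos)
  qed auto
  moreover have "s \<le> pi / 2" "0 < t" using assms by auto
  ultimately show ?thesis
    unfolding eq[OF assms(1) \<open>s \<le> pi / 2\<close>] eq[OF \<open>0 < t\<close> assms(3)]
    by (intro mult_strict_left_mono) auto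
qed

text \<open>Near 0, \<open>t - sinh t\<close> behaves like \<open>- t^3 / 6\<close> and
  \<open>sinh t * (cosh t - 1)\<close> like \<open>t^3 / 2\<close>, which gives
  \<open>1/2 - 1/6\<close>.\<close>

lemma hyp_weight_at_right_0: "(hyp_weight \<longlongrightarrow> 1 / 3) (at_right 0)"
  unfolding hyp_weight_def sinh_def cosh_def by (simp, real_asymp)

lemma hyp_weight_at_top: "(hyp_weight \<longlongrightarrow> 1 / 2) at_top"
  unfolding hyp_weight_def sinh_def cosh_def by (simp, real_asymp)

text \<open>Near 0, \<open>t - sin t * cos t\<close> behaves like \<open>2 * t^3 / 3\<close> and
  \<open>sin t * (1 - cos t)\<close> like \<open>t^3 / 2\<close>; the weight is half their
  quotient.\<close>

lemma trig_weight_at_right_0: "(trig_weight \<longlongrightarrow> 2 / 3) (at_right 0)"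
  unfolding trig_weight_def by real_asymp

lemma hyp_weight_at_left: "0 < t \<Longrightarrow> (hyp_weight \<longlongrightarrow> hyp_weight t) (at_left t)"
  unfolding hyp_weight_def using cosh_real_nonneg_less_iff[of 0 t] by (intro tendsto_intros) auto

lemma trig_weight_at_left:
  assumes "0 < t" "t < pi"
  shows "(trig_weight \<longlongrightarrow> trig_weight t) (at_left t)"
  unfolding trig_weight_def using assms cos_monotone_0_pi[of 0 t] sin_gt_zero[of t]
  by (intro tendsto_intros) auto

section \<open>Sharp bounds of strictly increasing functions\<close>

lemma strict_mono_lower_bounds:
  fixes f :: "real \<Rightarrow> real"
  assumes mono: "\<And>s t. \<lbrakk>0 < s; s < t; t < T\<rbrakk> \<Longrightarrow> f s < f t"
    and lim: "(f \<longlongrightarrow> l) (at_right 0)" and "0 < T"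
  shows "(\<forall>t. 0 < t \<and> t < T \<longrightarrow> c < f t) \<longleftrightarrow> c \<le> l"
proof
  assume "\<forall>t. 0 < t \<and> t < T \<longrightarrow> c < f t"
  then have "eventually (\<lambda>t. c \<le> f t) (at_right 0)"
    using \<open>0 < T\<close> unfolding eventually_at_right_field by (auto intro!: exI[of _ T] less_imp_le)
  then show "c \<le> l" using lim tendsto_lowerbound by force
next
  assume "c \<le> l"
  show "\<forall>t. 0 < t \<and> t < T \<longrightarrow> c < f t"
  proof (intro allI impI)
    fix t assume t: "0 < t \<and> t < T"
    \<comment> \<open>Passing to the limit keeps only a weak inequality; the intermediate point
      \<open>t / 2\<close> restores strictness.\<close>
    have "eventually (\<lambda>s. f s \<le> f (t / 2)) (at_right 0)"
      unfolding eventually_at_right_field using t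
      by (intro exI[of _ "t / 2"]) (auto intro!: less_imp_le mono)
    then have "l \<le> f (t / 2)" using lim tendsto_upperbound by force
    also have "\<dots> < f t" using t by (intro mono) auto
    finally show "c < f t" using \<open>c \<le> l\<close> by simp
  qed
qed

text \<open>Monotonicity up to and including \<open>T\<close> makes \<open>f T\<close> a strict
  bound on the open interval, and the left limit makes it the least one.\<close>

lemma strict_mono_upper_bounds:
  fixes f :: "real \<Rightarrow> real"
  assumes mono: "\<And>s t. \<lbrakk>0 < s; s < t; t \<le> T\<rbrakk> \<Longrightarrow> f s < f t"
    and lim: "(f \<longlongrightarrow> f T) (at_left T)" and "0 < T"
  shows "(\<forall>t. 0 < t \<and> t < T \<longrightarrow> f t < c) \<longleftrightarrow> f T \<le> c"
proof
  assume "\<forall>t. 0 < t \<and> t < T \<longrightarrow> f t < c"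
  then have "eventually (\<lambda>t. f t \<le> c) (at_left T)"
    using \<open>0 < T\<close> unfolding eventually_at_left_field by (auto intro!: exI[of _ 0] less_imp_le)
  then show "f T \<le> c" using lim tendsto_upperbound by force
qed (use mono in \<open>force intro: less_le_trans\<close>)

lemma strict_mono_upper_bounds_at_top:
  fixes f :: "real \<Rightarrow> real"
  assumes mono: "\<And>s t. \<lbrakk>0 < s; s < t\<rbrakk> \<Longrightarrow> f s < f t" and lim: "(f \<longlongrightarrow> l) at_top"
  shows "(\<forall>t>0. f t < c) \<longleftrightarrow> l \<le> c"
proof
  assume "\<forall>t>0. f t < c"
  then have "eventually (\<lambda>t. f t \<le> c) at_top"
    by (intro eventually_mono[OF eventually_gt_at_top[of 0]]) (auto intro: less_imp_le)
  then show "l \<le> c" using lim tendsto_upperbound by force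
next
  assume "l \<le> c"
  show "\<forall>t>0. f t < c"
  proof (intro allI impI)
    fix t :: real assume t: "0 < t"
    \<comment> \<open>The point \<open>t + 1\<close> keeps the inequality strict after the
      limit.\<close>
    have "f t < f (t + 1)" using t by (intro mono) auto
    also have "eventually (\<lambda>s. f (t + 1) \<le> f s) at_top"
      using t by (intro eventually_mono[OF eventually_gt_at_top[of "t + 1"]])
        (auto intro!: less_imp_le mono)
    then have "f (t + 1) \<le> l" using lim tendsto_lowerbound by force
    finally show "f t < c" using \<open>l \<le> c\<close> by simp
  qed
qed

section \<open>Neuman means as weighted combinations of their arguments\<close>

text \<open>With \<open>x = y * cosh t\<close> the root in the Schwab-Borchardt mean is
  \<open>y * sinh t\<close>, so that mean equals \<open>y * sinh t / t\<close>.\<close>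

lemma neuman_mean_hyp:
  assumes "0 < y" "y < x"
  shows "neuman_mean x y = hyp_weight (arcosh (x / y)) * x + (1 - hyp_weight (arcosh (x / y))) * y"
proof -
  define t where "t = arcosh (x / y)"
  have "x / y > 1" using assms by simp
  then have t: "t > 0" and x: "x = y * cosh t"
    using assms by (auto simp: t_def)
  have pos: "cosh t > 1" "sinh t > 0"
    using cosh_real_nonneg_less_iff[of 0 t] t by auto
  have "x\<^sup>2 - y\<^sup>2 = (y * sinh t)\<^sup>2"
    by (simp add: x power_mult_distrib cosh_square_eq algebra_simps)
  then have sb: "schwab_borchardt_mean x y = y * sinh t / t"
    using assms pos by (simp add: schwab_borchardt_mean_def t_def)
  then show ?thesis
    unfolding neuman_mean_def hyp_weight_def t_def[symmetric] sb
    using assms(1) pos t by (simp add: x divide_simps power2_eq_square) (simp add: algebra_simps)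
qed

text \<open>The same computation with \<open>x = y * cos t\<close> and root
  \<open>y * sin t\<close>. The second argument is now the larger one and carries the
  weight.\<close>

lemma neuman_mean_trig:
  assumes "0 < x" "x < y"
  shows "neuman_mean x y = trig_weight (arccos (x / y)) * y + (1 - trig_weight (arccos (x / y))) * x"
proof -
  define t where "t = arccos (x / y)"
  have y: "0 < y" and xy: "0 < x / y" "x / y < 1" using assms by auto
  have "- 1 < x / y" using xy by linarith
  then have t: "0 < t" "t < pi" and x: "x = y * cos t"
    using y xy arccos_lt_bounded[of "x / y"] by (auto simp: t_def)
  have pos: "cos t < 1" "sin t > 0"
    using t cos_monotone_0_pi[of 0 t] sin_gt_zero by auto
  have "y\<^sup>2 - x\<^sup>2 = (y * sin t)\<^sup>2"
    by (simp add: x power_mult_distrib sin_squared_eq algebra_simps)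
  then have sb: "schwab_borchardt_mean x y = y * sin t / t"
    using assms pos by (simp add: schwab_borchardt_mean_def t_def)
  then show ?thesis
    unfolding neuman_mean_def trig_weight_def t_def[symmetric] sb
    using y pos t by (simp add: x divide_simps power2_eq_square) (simp add: algebra_simps)
qed

text \<open>The difference of the two mixtures factors as \<open>(q - p) * (x - y)\<close>. This
  turns bounds between means into bounds on weights.\<close>

lemma mix_less_iff:
  fixes x y :: real
  assumes "y < x"
  shows "p * x + (1 - p) * y < q * x + (1 - q) * y \<longleftrightarrow> p < q"
proof -
  have "q * x + (1 - q) * y - (p * x + (1 - p) * y) = (q - p) * (x - y)"
    by (simp add: algebra_simps)
  then show ?thesis
    using assms by (smt (verit) zero_less_mult_iff)
qed

section \<open>Reduction to the single parameter \<open>u\<close>\<close>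

text \<open>The ratios to the arithmetic mean are \<open>4ab / (a + b)^2\<close> and
  \<open>2(a^2 + b^2) / (a + b)^2\<close>.\<close>

lemma means_eq:
  assumes "0 < a" "0 < b" "a \<noteq> b"
  defines "u \<equiv> ((a - b) / (a + b))\<^sup>2"
  shows "harmonic_mean a b = arithmetic_mean a b * (1 - u)"
    and "contraharmonic_mean a b = arithmetic_mean a b * (1 + u)"
    and "0 < u" "u < 1" "0 < arithmetic_mean a b"
proof -
  have "a + b \<noteq> 0" using assms by auto
  then show "harmonic_mean a b = arithmetic_mean a b * (1 - u)"
    "contraharmonic_mean a b = arithmetic_mean a b * (1 + u)"
    unfolding u_def harmonic_mean_def contraharmonic_mean_def arithmetic_mean_def power_divide
    by (simp_all add: divide_simps) algebra+
  have "(a + b)\<^sup>2 - (a - b)\<^sup>2 = 4 * (a * b)"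
    by (simp add: power2_eq_square algebra_simps)
  moreover have "0 < a * b" using assms by simp
  ultimately have "(a - b)\<^sup>2 < (a + b)\<^sup>2" by linarith
  then show "u < 1"
    unfolding u_def power_divide using \<open>a + b \<noteq> 0\<close> by (simp add: divide_less_eq_1)
qed (use assms in \<open>auto simp: arithmetic_mean_def\<close>)

lemma all_pos_distinct_iff:
  assumes "\<And>a b. \<lbrakk>0 < a; 0 < b; a \<noteq> b\<rbrakk> \<Longrightarrow> P a b \<longleftrightarrow> Q (((a - b) / (a + b))\<^sup>2)"
  shows "(\<forall>a b :: real. 0 < a \<longrightarrow> 0 < b \<longrightarrow> a \<noteq> b \<longrightarrow> P a b) \<longleftrightarrow> (\<forall>u. 0 < u \<longrightarrow> u < 1 \<longrightarrow> Q u)"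
proof (intro iffI allI impI)
  fix u :: real
  assume P: "\<forall>a b. 0 < a \<longrightarrow> 0 < b \<longrightarrow> a \<noteq> b \<longrightarrow> P a b" and u: "0 < u" "u < 1"
  \<comment> \<open>This pair has sum 2 and difference \<open>2 * sqrt u\<close>, so it realises the
    given \<open>u\<close>.\<close>
  have "0 < 1 + sqrt u" "0 < 1 - sqrt u" "1 + sqrt u \<noteq> 1 - sqrt u"
    using u real_sqrt_less_mono[of u 1] by (auto intro: add_pos_nonneg)
  note sqrt = this
  then have "P (1 + sqrt u) (1 - sqrt u)" using P by blast
  then show "Q u" using u assms[of "1 + sqrt u" "1 - sqrt u"] sqrt by simp
next
  fix a b :: real
  assume Q: "\<forall>u. 0 < u \<longrightarrow> u < 1 \<longrightarrow> Q u" and ab: "0 < a" "0 < b" "a \<noteq> b"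
  then show "P a b" using assms means_eq(3,4)[OF ab] by simp
qed

text \<open>Change of variable under a universal quantifier: the assumptions say that
  \<open>g\<close> maps \<open>(0, 1)\<close> onto the set described by \<open>R\<close>.\<close>

lemma all_image_iff:
  assumes "\<And>u. \<lbrakk>0 < u; u < 1\<rbrakk> \<Longrightarrow> R (g u)"
    and "\<And>t. R t \<Longrightarrow> \<exists>u>0. u < 1 \<and> g u = t"
  shows "(\<forall>u::real. 0 < u \<longrightarrow> u < 1 \<longrightarrow> P (g u)) \<longleftrightarrow> (\<forall>t. R t \<longrightarrow> P t)"
  using assms by metis

section \<open>Ranges of \<open>t\<close> for the four pairs of means\<close>

text \<open>Here \<open>cosh t = A / H = 1 / (1 - u)\<close> is unbounded as \<open>u\<close>
  approaches 1, so \<open>t\<close> takes every positive value.\<close>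

lemma range_AH:
  "(\<forall>u. 0 < u \<longrightarrow> u < 1 \<longrightarrow> P (arcosh (1 / (1 - u)))) \<longleftrightarrow> (\<forall>t::real. 0 < t \<longrightarrow> P t)"
proof (rule all_image_iff)
  fix t :: real assume "0 < t"
  then show "\<exists>u>0. u < 1 \<and> arcosh (1 / (1 - u)) = t"
    using cosh_real_nonneg_less_iff[of 0 t]
    by (intro exI[of _ "1 - 1 / cosh t"]) (auto simp: arcosh_cosh_real)
qed simp

lemma range_HA:
  "(\<forall>u. 0 < u \<longrightarrow> u < 1 \<longrightarrow> P (arccos (1 - u))) \<longleftrightarrow> (\<forall>t. 0 < t \<and> t < pi / 2 \<longrightarrow> P t)"
proof (rule all_image_iff)
  fix t :: real assume "0 < t \<and> t < pi / 2"
  then show "\<exists>u>0. u < 1 \<and> arccos (1 - u) = t"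
    using cos_gt_zero[of t] cos_monotone_0_pi[of 0 t]
    by (intro exI[of _ "1 - cos t"]) (auto simp: arccos_cos)
next
  fix u :: real assume "0 < u" "u < 1"
  then show "0 < arccos (1 - u) \<and> arccos (1 - u) < pi / 2"
    using arccos_less_mono[of 1 "1 - u"] arccos_less_mono[of "1 - u" 0] by auto
qed

lemma range_CA:
  "(\<forall>u. 0 < u \<longrightarrow> u < 1 \<longrightarrow> P (arcosh (1 + u))) \<longleftrightarrow> (\<forall>t::real. 0 < t \<and> t < arcosh 2 \<longrightarrow> P t)"
proof (rule all_image_iff)
  fix t :: real assume t: "0 < t \<and> t < arcosh 2"
  then have "cosh t < 2"
    using cosh_real_strict_mono[of t "arcosh 2"] by simp
  then show "\<exists>u>0. u < 1 \<and> arcosh (1 + u) = t"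
    using cosh_real_nonneg_less_iff[of 0 t] t
    by (intro exI[of _ "cosh t - 1"]) (auto simp: arcosh_cosh_real)
qed simp

text \<open>Here \<open>cos t = A / C = 1 / (1 + u)\<close> sweeps the interval from
  \<open>1/2\<close> to 1, and \<open>cos (pi / 3) = 1/2\<close>.\<close>

lemma range_AC:
  "(\<forall>u. 0 < u \<longrightarrow> u < 1 \<longrightarrow> P (arccos (1 / (1 + u)))) \<longleftrightarrow> (\<forall>t. 0 < t \<and> t < pi / 3 \<longrightarrow> P t)"
proof (rule all_image_iff)
  fix t :: real assume t: "0 < t \<and> t < pi / 3"
  have "1 / 2 < cos t" using t cos_monotone_0_pi[of t "pi / 3"] by (simp add: cos_60)
  moreover have "cos t < 1" using t cos_monotone_0_pi[of 0 t] by simp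
  ultimately show "\<exists>u>0. u < 1 \<and> arccos (1 / (1 + u)) = t" using t
    by (intro exI[of _ "1 / cos t - 1"]) (auto simp: arccos_cos field_simps)
next
  fix u :: real assume u: "0 < u" "u < 1"
  have "arccos (1 / 2) = pi / 3" using arccos_cos[of "pi / 3"] by (simp add: cos_60)
  then show "0 < arccos (1 / (1 + u)) \<and> arccos (1 / (1 + u)) < pi / 3"
    using u arccos_less_mono[of 1 "1 / (1 + u)"] arccos_less_mono[of "1 / (1 + u)" "1 / 2"] 
    by (auto simp: field_simps)
qed

section \<open>Endpoint values and sharp constants\<close>

text \<open>At \<open>cosh t = 2\<close> the terms \<open>cosh t - 2\<close> in the numerator
  cancel, the denominator is 2, and \<open>sinh t = sqrt 3\<close>.\<close>

lemma hyp_weight_arcosh_2: "hyp_weight (arcosh 2) = sqrt 3 * ln (2 + sqrt 3) / 6"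
proof -
  have "hyp_weight (arcosh 2) = arcosh 2 / sqrt 3 / 2"
    by (simp add: hyp_weight_def sinh_arcosh_real)
  also have "\<dots> = sqrt 3 * arcosh 2 / 6"
    by (simp add: field_simps)
  finally show ?thesis by (simp add: arcosh_real_def)
qed

lemma trig_weight_pi_half: "trig_weight (pi / 2) = pi / 4"
  by (simp add: trig_weight_def)

lemma trig_weight_pi_third: "trig_weight (pi / 3) = (4 * sqrt 3 * pi - 9) / 18"
  by (simp add: trig_weight_def cos_60 sin_60 field_simps)

lemma neuman_bounds_iff:
  assumes "0 < a" "0 < b" "a \<noteq> b"
  defines "u \<equiv> ((a - b) / (a + b))\<^sup>2"
  shows "p * arithmetic_mean a b + (1 - p) * harmonic_mean a b < neuman_AH a b
      \<longleftrightarrow> p < hyp_weight (arcosh (1 / (1 - u)))"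
    and "neuman_AH a b < p * arithmetic_mean a b + (1 - p) * harmonic_mean a b
      \<longleftrightarrow> hyp_weight (arcosh (1 / (1 - u))) < p"
    and "p * arithmetic_mean a b + (1 - p) * harmonic_mean a b < neuman_HA a b
      \<longleftrightarrow> p < trig_weight (arccos (1 - u))"
    and "neuman_HA a b < p * arithmetic_mean a b + (1 - p) * harmonic_mean a b
      \<longleftrightarrow> trig_weight (arccos (1 - u)) < p"
    and "p * contraharmonic_mean a b + (1 - p) * arithmetic_mean a b < neuman_CA a b
      \<longleftrightarrow> p < hyp_weight (arcosh (1 + u))"
    and "neuman_CA a b < p * contraharmonic_mean a b + (1 - p) * arithmetic_mean a b
      \<longleftrightarrow> hyp_weight (arcosh (1 + u)) < p"
    and "p * contraharmonic_mean a b + (1 - p) * arithmetic_mean a b < neuman_AC a b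
      \<longleftrightarrow> p < trig_weight (arccos (1 / (1 + u)))"
    and "neuman_AC a b < p * contraharmonic_mean a b + (1 - p) * arithmetic_mean a b
      \<longleftrightarrow> trig_weight (arccos (1 / (1 + u))) < p"
proof -
  define A where "A = arithmetic_mean a b"
  have u: "0 < u" "u < 1" and A: "0 < A"
    and H: "harmonic_mean a b = A * (1 - u)" and C: "contraharmonic_mean a b = A * (1 + u)"
    using means_eq[OF assms(1-3)] by (simp_all add: A_def u_def)
  \<comment> \<open>The order \<open>H < A < C\<close> selects the case: hyperbolic for
    \<open>neuman_AH\<close> and \<open>neuman_CA\<close>, trigonometric for
    \<open>neuman_HA\<close> and \<open>neuman_AC\<close>.\<close>
  have order: "0 < A * (1 - u)" "A * (1 - u) < A" "A < A * (1 + u)"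
    using u A by simp_all
  have "A / (A * (1 - u)) = 1 / (1 - u)" "A / (A * (1 + u)) = 1 / (1 + u)"
    "A * (1 - u) / A = 1 - u" "A * (1 + u) / A = 1 + u"
    using A by simp_all
  note eqs = this neuman_mean_hyp[OF order(1,2)] neuman_mean_trig[OF order(1,2)]
    neuman_mean_hyp[OF A order(3)] neuman_mean_trig[OF A order(3)]
  show "p * arithmetic_mean a b + (1 - p) * harmonic_mean a b < neuman_AH a b
      \<longleftrightarrow> p < hyp_weight (arcosh (1 / (1 - u)))"
    "neuman_AH a b < p * arithmetic_mean a b + (1 - p) * harmonic_mean a b
      \<longleftrightarrow> hyp_weight (arcosh (1 / (1 - u))) < p"
    "p * arithmetic_mean a b + (1 - p) * harmonic_mean a b < neuman_HA a b
      \<longleftrightarrow> p < trig_weight (arccos (1 - u))"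
    "neuman_HA a b < p * arithmetic_mean a b + (1 - p) * harmonic_mean a b
      \<longleftrightarrow> trig_weight (arccos (1 - u)) < p"
    "p * contraharmonic_mean a b + (1 - p) * arithmetic_mean a b < neuman_CA a b
      \<longleftrightarrow> p < hyp_weight (arcosh (1 + u))"
    "neuman_CA a b < p * contraharmonic_mean a b + (1 - p) * arithmetic_mean a b
      \<longleftrightarrow> hyp_weight (arcosh (1 + u)) < p"
    "p * contraharmonic_mean a b + (1 - p) * arithmetic_mean a b < neuman_AC a b
      \<longleftrightarrow> p < trig_weight (arccos (1 / (1 + u)))"
    "neuman_AC a b < p * contraharmonic_mean a b + (1 - p) * arithmetic_mean a b
      \<longleftrightarrow> trig_weight (arccos (1 / (1 + u))) < p"
    unfolding neuman_AH_def neuman_HA_def neuman_CA_def neuman_AC_def H C A_def[symmetric] eqs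
      mix_less_iff[OF order(2)] mix_less_iff[OF order(3)]
    by (rule refl)+
qed

lemma hyp_weight_lower_iff:
  "0 < T \<Longrightarrow> (\<forall>t. 0 < t \<and> t < T \<longrightarrow> c < hyp_weight t) \<longleftrightarrow> c \<le> 1 / 3"
  by (rule strict_mono_lower_bounds[OF _ hyp_weight_at_right_0]) (auto intro: hyp_weight_strict_mono)

lemma hyp_weight_pos_lower_iff: "(\<forall>t>0. c < hyp_weight t) \<longleftrightarrow> c \<le> 1 / 3"
proof -
  have "(\<forall>t>0. c < hyp_weight t) \<longleftrightarrow> (\<forall>t. 0 < t \<and> t < 1 \<longrightarrow> c < hyp_weight t)"
  proof (intro iffI allI impI)
    fix t :: real assume c: "\<forall>t. 0 < t \<and> t < 1 \<longrightarrow> c < hyp_weight t" and "0 < t"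
    \<comment> \<open>Lower bounds are decided near 0: \<open>min t (1 / 2)\<close> lies in
      \<open>(0, 1)\<close> and does not exceed \<open>t\<close>, so monotonicity carries the bound
      to large \<open>t\<close>.\<close>
    then have "c < hyp_weight (min t (1 / 2))" by simp
    also have "\<dots> \<le> hyp_weight t"
      using hyp_weight_strict_mono[of "1 / 2" t] by (auto simp: min_def)
    finally show "c < hyp_weight t" .
  qed simp
  then show ?thesis using hyp_weight_lower_iff[of 1 c] by simp
qed

lemma hyp_weight_upper_iff:
  "0 < T \<Longrightarrow> (\<forall>t. 0 < t \<and> t < T \<longrightarrow> hyp_weight t < c) \<longleftrightarrow> hyp_weight T \<le> c"
  by (rule strict_mono_upper_bounds) (auto intro: hyp_weight_strict_mono hyp_weight_at_left)

lemma hyp_weight_pos_upper_iff: "(\<forall>t>0. hyp_weight t < c) \<longleftrightarrow> 1 / 2 \<le> c"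
  using hyp_weight_strict_mono hyp_weight_at_top by (rule strict_mono_upper_bounds_at_top)

lemma trig_weight_lower_iff:
  "\<lbrakk>0 < T; T \<le> pi / 2\<rbrakk> \<Longrightarrow> (\<forall>t. 0 < t \<and> t < T \<longrightarrow> c < trig_weight t) \<longleftrightarrow> c \<le> 2 / 3"
  by (rule strict_mono_lower_bounds[OF _ trig_weight_at_right_0]) (auto intro: trig_weight_strict_mono)

lemma trig_weight_upper_iff:
  "\<lbrakk>0 < T; T \<le> pi / 2\<rbrakk> \<Longrightarrow> (\<forall>t. 0 < t \<and> t < T \<longrightarrow> trig_weight t < c) \<longleftrightarrow> trig_weight T \<le> c"
  by (rule strict_mono_upper_bounds) (auto intro: trig_weight_strict_mono trig_weight_at_left)

theorem theorem1p2:
  fixes \<alpha>\<^sub>1 \<alpha>\<^sub>2 \<alpha>\<^sub>3 \<alpha>\<^sub>4 \<beta>\<^sub>1 \<beta>\<^sub>2 \<beta>\<^sub>3 \<beta>\<^sub>4 :: real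
  shows "(\<forall>a b :: real. a > 0 \<longrightarrow> b > 0 \<longrightarrow> a \<noteq> b \<longrightarrow>
        \<alpha>\<^sub>1 * arithmetic_mean a b + (1 - \<alpha>\<^sub>1) * harmonic_mean a b < neuman_AH a b \<and>
        neuman_AH a b < \<beta>\<^sub>1 * arithmetic_mean a b + (1 - \<beta>\<^sub>1) * harmonic_mean a b \<and>
        \<alpha>\<^sub>2 * arithmetic_mean a b + (1 - \<alpha>\<^sub>2) * harmonic_mean a b < neuman_HA a b \<and>
        neuman_HA a b < \<beta>\<^sub>2 * arithmetic_mean a b + (1 - \<beta>\<^sub>2) * harmonic_mean a b \<and>
        \<alpha>\<^sub>3 * contraharmonic_mean a b + (1 - \<alpha>\<^sub>3) * arithmetic_mean a b < neuman_CA a b \<and>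
        neuman_CA a b < \<beta>\<^sub>3 * contraharmonic_mean a b + (1 - \<beta>\<^sub>3) * arithmetic_mean a b \<and>
        \<alpha>\<^sub>4 * contraharmonic_mean a b + (1 - \<alpha>\<^sub>4) * arithmetic_mean a b < neuman_AC a b \<and>
        neuman_AC a b < \<beta>\<^sub>4 * contraharmonic_mean a b + (1 - \<beta>\<^sub>4) * arithmetic_mean a b)
    \<longleftrightarrow>
      (\<alpha>\<^sub>1 \<le> 1 / 3 \<and> \<beta>\<^sub>1 \<ge> 1 / 2 \<and>
       \<alpha>\<^sub>2 \<le> 2 / 3 \<and> \<beta>\<^sub>2 \<ge> pi / 4 \<and>
       \<alpha>\<^sub>3 \<le> 1 / 3 \<and> \<beta>\<^sub>3 \<ge> sqrt 3 * ln (2 + sqrt 3) / 6 \<and>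
       \<alpha>\<^sub>4 \<le> 2 / 3 \<and> \<beta>\<^sub>4 \<ge> (4 * sqrt 3 * pi - 9) / 18)"
(is "?bounds \<longleftrightarrow> ?params")
proof -
  let ?Q = "\<lambda>u.
    \<alpha>\<^sub>1 < hyp_weight (arcosh (1 / (1 - u))) \<and> hyp_weight (arcosh (1 / (1 - u))) < \<beta>\<^sub>1 \<and>
    \<alpha>\<^sub>2 < trig_weight (arccos (1 - u)) \<and> trig_weight (arccos (1 - u)) < \<beta>\<^sub>2 \<and>
    \<alpha>\<^sub>3 < hyp_weight (arcosh (1 + u)) \<and> hyp_weight (arcosh (1 + u)) < \<beta>\<^sub>3 \<and>
    \<alpha>\<^sub>4 < trig_weight (arccos (1 / (1 + u))) \<and> trig_weight (arccos (1 / (1 + u))) < \<beta>\<^sub>4"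
  have arcosh_2: "(0::real) < arcosh 2" by simp
  have pi_half: "0 < pi / 2" "pi / 2 \<le> pi / 2" and pi_third: "0 < pi / 3" "pi / 3 \<le> pi / 2"
    by simp_all
  have "?bounds \<longleftrightarrow> (\<forall>u. 0 < u \<longrightarrow> u < 1 \<longrightarrow> ?Q u)"
    by (rule all_pos_distinct_iff[where Q = ?Q]) (intro conj_cong neuman_bounds_iff; assumption)
  also have "\<dots> \<longleftrightarrow> ?params"
    \<comment> \<open>The quantifier over \<open>u\<close> distributes over the eight inequalities,
      so each constant is determined separately, in the variable \<open>t\<close> of its own
      mean.\<close>
    unfolding imp_conjR all_conj_distrib
      range_AH[of "\<lambda>t. _ < hyp_weight t"] range_AH[of "\<lambda>t. hyp_weight t < _"]
      range_HA[of "\<lambda>t. _ < trig_weight t"] range_HA[of "\<lambda>t. trig_weight t < _"]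
      range_CA[of "\<lambda>t. _ < hyp_weight t"] range_CA[of "\<lambda>t. hyp_weight t < _"]
      range_AC[of "\<lambda>t. _ < trig_weight t"] range_AC[of "\<lambda>t. trig_weight t < _"]
      hyp_weight_pos_lower_iff hyp_weight_pos_upper_iff
      hyp_weight_lower_iff[OF arcosh_2] hyp_weight_upper_iff[OF arcosh_2]
      trig_weight_lower_iff[OF pi_half] trig_weight_upper_iff[OF pi_half]
      trig_weight_lower_iff[OF pi_third] trig_weight_upper_iff[OF pi_third]
      hyp_weight_arcosh_2 trig_weight_pi_half trig_weight_pi_third
    by (rule refl)
  finally show ?thesis .
qed

end
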